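(* Let $T>0$, $\rho\in(0,1)$, $q\in(1/\rho,\infty]$, and let $g\in L^q(0,T;\mathbb{R})$ with $g(t)\ge 0$ for almost every $t\in[0,T]$. Then there exists $n_0\in\mathbb{N}$ such that $$\underbrace{J_t^\rho\Big\{g(t)J_t^\rho\Big[g(t)J_t^\rho\Big(\cdots g(t)J_t^\rho g(t)\Big)\Big]\Big\}}_{n_0\text{ times}}<1\quad\text{for a.e. }t\in[0,T];$$ that is, defining recursively $G_1:=J_t^\rho g$ and $G_{k+1}:=J_t^\rho(g\,G_k)$ for $k\ge1$, one has $G_{n_0}(t)<1$ for almost every $t\in[0,T]$.
   Context: For $\rho>0$ and $h\in L^1(0,T;\mathbb{R})$, the Riemann–Liouville fractional integral of order $\rho$ is $J_t^\rho h(t)=\frac{1}{\Gamma(\rho)}\int_0^t(t-s)^{\rho-1}h(s)\,ds$ for a.e. $t\in[0,T]$. $\mathbb{N}=\{1,2,\dots\}$. *)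

theory Defs
  imports "HOL-Analysis.Analysis"
begin

text \<open>Membership in the Lebesgue space of exponent \<open>p \<in> [1,\<infinity>]\<close>, for representatives rather than
  classes modulo null sets.\<close>

definition in_Lp :: "ereal \<Rightarrow> 'a measure \<Rightarrow> ('a \<Rightarrow> real) \<Rightarrow> bool" where
  "in_Lp p M f \<longleftrightarrow> 1 \<le> p \<and> f \<in> borel_measurable M \<and>
     (if p = \<infinity> then \<exists>C. AE x in M. \<bar>f x\<bar> \<le> C
      else integrable M (\<lambda>x. \<bar>f x\<bar> powr real_of_ereal p))"

text \<open>At \<open>s = t\<close> the kernel evaluates to \<open>0 powr (\<rho> - 1) = 0\<close>, which only affects a null set.
  The integral is the Bochner integral, hence \<open>0\<close> if the integrand is not integrable; for
  \<open>0 < \<rho>\<close> and \<open>h\<close> integrable on \<open>[0,T]\<close> this happens only for \<open>t\<close> in a null subset of \<open>[0,T]\<close>.\<close>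

definition RL_integral :: "real \<Rightarrow> (real \<Rightarrow> real) \<Rightarrow> real \<Rightarrow> real" where
  "RL_integral \<rho> h t = 1 / Gamma \<rho> * (LINT s:{0..t}|lebesgue. (t - s) powr (\<rho> - 1) * h s)"

text \<open>The sequence starts at index 1; the value at 0 is an arbitrary filler.\<close>

fun RL_iter :: "real \<Rightarrow> (real \<Rightarrow> real) \<Rightarrow> nat \<Rightarrow> real \<Rightarrow> real" where
  "RL_iter \<rho> g 0 = (\<lambda>t. 1)"
| "RL_iter \<rho> g (Suc 0) = RL_integral \<rho> g"
| "RL_iter \<rho> g (Suc (Suc k)) = RL_integral \<rho> (\<lambda>t. g t * RL_iter \<rho> g (Suc k) t)"

end

theory Submission
  imports Defs
begin

text \<open>Measured against the weight \<open>exp (\<lambda> t)\<close>, the positive operator \<open>h \<mapsto> J\<^sub>t\<^sup>\<rho> (g h)\<close> is a contraction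
  once \<open>\<lambda>\<close> is large: its kernel becomes \<open>(t - s) powr (\<rho> - 1) * exp (- \<lambda> (t - s)) * g s\<close>, and
  \<open>exp (- x) \<le> x powr (- \<beta>)\<close> extracts a factor \<open>\<lambda> powr (- \<beta>)\<close> while the remaining kernel
  \<open>r powr (\<rho> - 1 - \<beta>)\<close> stays in the dual space of \<open>L\<^sup>q\<close> for small \<open>\<beta>\<close>. With contraction factor
  \<open>1/2\<close> the \<open>n\<close>-th iterate is at most \<open>(1/2) ^ n * exp (\<lambda> T)\<close>.\<close>

text \<open>Removes the case \<open>q = \<infinity>\<close>: on a finite measure space an
  essentially bounded function has integrable powers, so \<open>r + 1\<close> serves as exponent. A
  finite \<open>q\<close> is itself the exponent.\<close>

lemma (in finite_measure) in_Lp_integrable_powr: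
  fixes f :: "'a \<Rightarrow> real"
  assumes "in_Lp q M f" and "0 < r" and "ereal r < q"
  obtains p where "r < p" and "integrable M (\<lambda>x. \<bar>f x\<bar> powr p)"
proof (cases q)
  case (real p)
  with assms that[of p] show ?thesis by (auto simp: in_Lp_def)
next
  case PInf
  then obtain C where C: "AE x in M. \<bar>f x\<bar> \<le> C" and [measurable]: "f \<in> borel_measurable M"
    using assms by (auto simp: in_Lp_def)
  have "integrable M (\<lambda>x. \<bar>f x\<bar> powr (r + 1))"
  proof (rule integrable_const_bound)
    show "AE x in M. norm (\<bar>f x\<bar> powr (r + 1)) \<le> C powr (r + 1)"
      using C by eventually_elim (use \<open>0 < r\<close> in \<open>auto intro!: powr_mono2\<close>)
  qed measurable
  with that[of "r + 1"] show ?thesis by simp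
next
  case MInf
  with assms show ?thesis by simp
qed

lemma exp_minus_le_powr:
  fixes x b :: real
  assumes "0 < x" and "0 \<le> b" and "b \<le> 1"
  shows "exp (- x) \<le> x powr (- b)"
proof -
  have "b * ln x \<le> x"
  proof (cases "0 \<le> ln x")
    case True
    then have "b * ln x \<le> ln x" using assms by (simp add: mult_left_le_one_le)
    also have "\<dots> \<le> x" using ln_bound[OF assms(1)] .
    finally show ?thesis .
  next
    case False
    then have "b * ln x \<le> 0" using assms by (simp add: mult_nonneg_nonpos)
    with assms show ?thesis by simp
  qed
  with assms show ?thesis by (simp add: powr_def)
qed

lemma has_bochner_integral_reflected_powr:
  fixes a t :: real
  assumes "-1 < a" and "0 \<le> t"
  shows "has_bochner_integral lebesgue (\<lambda>s. indicator {0..t} s * (t - s) powr a)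
    (t powr (a + 1) / (a + 1))"
proof -
  have img: "(\<lambda>x. t - x) ` {0..t} = {0..t}"
    by (auto simp: image_iff intro: bexI[of _ "t - _"])
  have "((\<lambda>x. x powr a) has_integral (t powr (a + 1) / (a + 1))) (cbox 0 t)"
    using has_integral_powr_from_0[OF assms] by simp
  from has_integral_affinity[OF this, of "-1" t]
  have I: "((\<lambda>s. (t - s) powr a) has_integral (t powr (a + 1) / (a + 1))) {0..t}"
    by (simp add: img)
  then have "(\<lambda>s. (t - s) powr a) absolutely_integrable_on {0..t}"
    by (intro nonnegative_absolutely_integrable_1) auto
  moreover from this have "(LINT s:{0..t}|lebesgue. (t - s) powr a) = t powr (a + 1) / (a + 1)"
    using I by (simp add: set_lebesgue_integral_eq_integral(2) integral_unique)
  ultimately show ?thesis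
    by (simp add: has_bochner_integral_iff set_integrable_def set_lebesgue_integral_def)
qed

lemma mult_le_powr_add_powr:
  fixes a b p q :: real
  assumes "1 < p" and "1 < q" and "1 / p + 1 / q = 1" and "0 \<le> a" and "0 \<le> b"
  shows "a * b \<le> a powr p + b powr q"
proof -
  have "a * b \<le> a powr p / p + b powr q / q"
    by (rule Youngs_inequality) fact+
  also have "\<dots> \<le> a powr p + b powr q"
    using assms by (intro add_mono) (simp_all add: divide_le_eq mult_left_le mult_le_cancel_left1)
  finally show ?thesis .
qed

text \<open>The contraction estimate with factor \<open>e\<close>. Since \<open>l\<close> is chosen
  before \<open>h\<close>, \<open>c\<close> and \<open>t\<close>, one weight serves all
  iterates.\<close>

lemma RL_integral_exp_bound:
  fixes T \<rho> q :: real
  assumes "0 < T" and "0 < \<rho>" and "\<rho> < 1" and "1 / \<rho> < q" and "0 < e"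
    and int: "integrable (lebesgue_on {0<..<T}) (\<lambda>s. \<bar>g s\<bar> powr q)"
    and nonneg: "AE s in lebesgue_on {0..T}. 0 \<le> g s"
  obtains l where "0 < l" and
    "\<And>h c t. \<lbrakk>0 \<le> t; t \<le> T; 0 \<le> c; AE s in lebesgue_on {0..T}. h s \<le> c * exp (l * s) * g s\<rbrakk>
      \<Longrightarrow> RL_integral \<rho> h t \<le> e * c * exp (l * t)"
proof -
  define p where "p = q / (q - 1)"
  have "1 < q"
    using assms by (smt (verit) divide_less_eq_1_pos le_divide_eq_1_pos)
  then have "1 < p" and pq: "1 / p + 1 / q = 1"
    by (simp_all add: p_def field_simps)
  define u where "u = 1 / q"
  have u: "0 < u" "u < \<rho>" "1 / p = 1 - u"
    using assms \<open>1 < q\<close> pq by (simp_all add: u_def field_simps)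
  \<comment> \<open>The power \<open>(\<rho> - 1 - b) * p\<close> of the kernel is integrable at 0
    iff it exceeds -1, that is, iff \<open>b < \<rho> - u\<close>; half of this bound is
    taken.\<close>
  define b where "b = (\<rho> - u) / 2"
  have b: "0 < b" "b \<le> 1"
    using u \<open>\<rho> < 1\<close> by (simp_all add: b_def)
  define a where "a = (\<rho> - 1 - b) * p"
  have "- (1 / p) < \<rho> - 1 - b"
    using u by (simp add: b_def field_simps)
  then have a: "-1 < a"
    using \<open>1 < p\<close> by (simp add: a_def field_simps)
  define w where "w s = indicator {0<..<T} s * \<bar>g s\<bar> powr q" for s
  have w: "integrable lebesgue w" "\<And>s. 0 \<le> w s"
    using int by (simp_all add: w_def[abs_def] integrable_restrict_space)
  \<comment> \<open>Bounds the integrals of the two Young terms together, uniformly in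
    \<open>t \<le> T\<close>.\<close>
  define C where "C = T powr (a + 1) / (a + 1) + integral\<^sup>L lebesgue w"
  have "0 \<le> C"
    using a w by (simp add: C_def)
  have \<Gamma>: "0 < Gamma \<rho>"
    using assms by (simp add: Gamma_real_pos)
  \<comment> \<open>Chosen so that \<open>l powr (- b) * C \<le> e * Gamma \<rho>\<close>; the
    summand 1 makes the base positive from \<open>0 \<le> C\<close> alone.\<close>
  define l where "l = (C / (Gamma \<rho> * e) + 1) powr (1 / b)"
  have pos: "0 < C / (Gamma \<rho> * e) + 1"
    using \<open>0 \<le> C\<close> \<Gamma> \<open>0 < e\<close> by (simp add: add_nonneg_pos)
  then have "0 < l" by (simp add: l_def)
  have "l powr b = C / (Gamma \<rho> * e) + 1"
    using pos b by (simp add: l_def powr_powr)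
  then have "C \<le> e * Gamma \<rho> * l powr b"
    using \<Gamma> \<open>0 < e\<close> by (simp add: field_simps)
  then have lC: "l powr (- b) * C \<le> e * Gamma \<rho>"
    using \<open>0 < l\<close> by (simp add: powr_minus_divide pos_divide_le_eq)
  have kernel: "r powr (\<rho> - 1) * exp (- (l * r)) \<le> l powr (- b) * r powr (\<rho> - 1 - b)"
    if "0 \<le> r" for r
  \<comment> \<open>At \<open>r = 0\<close> both sides vanish, because \<open>0 powr x = 0\<close>
    for every \<open>x\<close>.\<close>
  proof (cases "r = 0")
    case False
    then have "exp (- (l * r)) \<le> (l * r) powr (- b)"
      using that \<open>0 < l\<close> b by (intro exp_minus_le_powr) auto
    then have "r powr (\<rho> - 1) * exp (- (l * r)) \<le> r powr (\<rho> - 1) * (l * r) powr (- b)"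
      by (intro mult_left_mono) auto
    also have "\<dots> = l powr (- b) * r powr (\<rho> - 1 - b)"
      using that \<open>0 < l\<close> by (simp add: powr_mult flip: powr_add)
    finally show ?thesis .
  qed simp
  show thesis
  proof (rule that[OF \<open>0 < l\<close>])
    fix h c t
    assume t: "0 \<le> t" "t \<le> T" and "0 \<le> c"
      and h: "AE s in lebesgue_on {0..T}. h s \<le> c * exp (l * s) * g s"
    define D where "D = l powr (- b) * (c * exp (l * t))"
    define B where "B s = D * (indicator {0..t} s * (t - s) powr a + w s)" for s
    have "0 \<le> D" using \<open>0 \<le> c\<close> by (simp add: D_def)
    have K: "has_bochner_integral lebesgue (\<lambda>s. indicator {0..t} s * (t - s) powr a)
        (t powr (a + 1) / (a + 1))"
      using has_bochner_integral_reflected_powr[OF a t(1)] .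
    have B: "has_bochner_integral lebesgue B
        (D * (t powr (a + 1) / (a + 1) + integral\<^sup>L lebesgue w))"
      unfolding B_def[abs_def]
      using K w by (intro has_bochner_integral_mult_right has_bochner_integral_add)
        (auto simp: has_bochner_integral_iff)
    have Icc: "AE s in lebesgue. s \<in> {0..T} \<longrightarrow> P s" if "AE s in lebesgue_on {0..T}. P s" for P
      using that by (simp add: AE_restrict_space_iff)
    \<comment> \<open>The endpoints must go: \<open>w\<close> is cut off to the open interval, so
      \<open>B\<close> need not dominate there.\<close>
    have "AE s in lebesgue. s \<noteq> 0" "AE s in lebesgue. s \<noteq> T"
      by (auto intro!: AE_completion AE_lborel_singleton)
    with Icc[OF h] Icc[OF nonneg]
    have le: "AE s in lebesgue. indicator {0..t} s *\<^sub>R ((t - s) powr (\<rho> - 1) * h s) \<le> B s"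
    proof eventually_elim
      case (elim s)
      show ?case
      proof (cases "s \<in> {0..t}")
        case False
        then show ?thesis using w(2) \<open>0 \<le> D\<close> by (simp add: B_def)
      next
        case True
        then have s: "s \<in> {0..T}" "s \<in> {0<..<T}" "0 \<le> t - s" using elim t by auto
        have gs: "0 \<le> g s" using elim s by auto
        have "(t - s) powr (\<rho> - 1) * h s \<le> (t - s) powr (\<rho> - 1) * (c * exp (l * s) * g s)"
          using elim s by (intro mult_left_mono) auto
        \<comment> \<open>The weight at \<open>s\<close> splits into a decaying factor, joined to
          the kernel, and the weight at \<open>t\<close>, constant under the integral.\<close>
        also have "\<dots> = ((t - s) powr (\<rho> - 1) * exp (- (l * (t - s)))) * (c * exp (l * t) * g s)"
          by (simp add: algebra_simps flip: exp_add)
        also have "\<dots> \<le> (l powr (- b) * (t - s) powr (\<rho> - 1 - b)) * (c * exp (l * t) * g s)"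
          using kernel[OF s(3)] gs \<open>0 \<le> c\<close> by (intro mult_right_mono) auto
        also have "\<dots> = D * ((t - s) powr (\<rho> - 1 - b) * g s)"
          by (simp add: D_def)
        also have "\<dots> \<le> D * (((t - s) powr (\<rho> - 1 - b)) powr p + g s powr q)"
          using \<open>0 \<le> D\<close> \<open>1 < p\<close> \<open>1 < q\<close> pq gs
          by (intro mult_left_mono mult_le_powr_add_powr) auto
        also have "\<dots> = B s"
          using True s gs by (simp add: B_def w_def powr_powr a_def)
        finally show ?thesis using True by simp
      qed
    qed
    \<comment> \<open>No measurability of \<open>h\<close> is required: if the left integrand is not
      integrable, its integral is 0, and \<open>B\<close> is nonnegative almost everywhere.\<close>
    have "(LINT s:{0..t}|lebesgue. (t - s) powr (\<rho> - 1) * h s) \<le> integral\<^sup>L lebesgue B"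
      unfolding set_lebesgue_integral_def
    proof (rule integral_mono_AE'[OF _ le])
      show "integrable lebesgue B" using B by (simp add: has_bochner_integral_iff)
      show "AE s in lebesgue. 0 \<le> B s" using w(2) \<open>0 \<le> D\<close> by (simp add: B_def)
    qed
    also have "\<dots> = D * (t powr (a + 1) / (a + 1) + integral\<^sup>L lebesgue w)"
      using B by (simp add: has_bochner_integral_iff)
    also have "\<dots> \<le> D * C"
      unfolding C_def using \<open>0 \<le> D\<close> t a
      by (intro mult_left_mono add_right_mono divide_right_mono powr_mono2) auto
    also have "\<dots> = l powr (- b) * C * (c * exp (l * t))"
      by (simp add: D_def)
    also have "\<dots> \<le> e * Gamma \<rho> * (c * exp (l * t))"
      using lC \<open>0 \<le> c\<close> by (intro mult_right_mono) auto
    finally show "RL_integral \<rho> h t \<le> e * c * exp (l * t)"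
      using \<Gamma> by (simp add: RL_integral_def field_simps)
  qed
qed

theorem lemma13:
  fixes T \<rho> :: real and q :: ereal and g :: "real \<Rightarrow> real"
  assumes "0 < T"
    and "0 < \<rho>" and "\<rho> < 1"
    and "ereal (1 / \<rho>) < q"
    and "in_Lp q (lebesgue_on {0<..<T}) g"
    and "AE t in lebesgue_on {0..T}. 0 \<le> g t"
  shows "\<exists>n\<^sub>0\<ge>1. AE t in lebesgue_on {0..T}. RL_iter \<rho> g n\<^sub>0 t < 1"
proof -
  interpret finite_measure "lebesgue_on {0<..<T}"
    by (rule finite_measure_lebesgue_on) auto
  obtain q' where q': "1 / \<rho> < q'" "integrable (lebesgue_on {0<..<T}) (\<lambda>s. \<bar>g s\<bar> powr q')"
    using in_Lp_integrable_powr[OF assms(5) _ assms(4)] assms(2) by auto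
  obtain l where "0 < l" and contract:
    "\<And>h c t. \<lbrakk>0 \<le> t; t \<le> T; 0 \<le> c; AE s in lebesgue_on {0..T}. h s \<le> c * exp (l * s) * g s\<rbrakk>
      \<Longrightarrow> RL_integral \<rho> h t \<le> 1 / 2 * c * exp (l * t)"
    using RL_integral_exp_bound[OF assms(1-3) q'(1) _ q'(2) assms(6), of "1 / 2"] by auto
  have bound: "RL_iter \<rho> g (Suc n) t \<le> (1 / 2) ^ Suc n * exp (l * t)" if "0 \<le> t" "t \<le> T" for n t
    using that
  proof (induction n arbitrary: t)
    case 0
    \<comment> \<open>The iteration starts from the constant function 1, which lies below the weight
      since \<open>0 \<le> l * s\<close>.\<close>
    have "AE s in lebesgue_on {0..T}. g s \<le> 1 * exp (l * s) * g s"
      using assms(6) AE_space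
      by eventually_elim (use \<open>0 < l\<close> in \<open>auto intro!: mult_left_le_one_le simp: mult_le_cancel_right1\<close>)
    with 0 contract[of t 1 g] show ?case by simp
  next
    case (Suc n)
    have "AE s in lebesgue_on {0..T}.
        g s * RL_iter \<rho> g (Suc n) s \<le> (1 / 2) ^ Suc n * exp (l * s) * g s"
      using assms(6) AE_space
    proof eventually_elim
      case (elim s)
      then have "g s * RL_iter \<rho> g (Suc n) s \<le> g s * ((1 / 2) ^ Suc n * exp (l * s))"
        by (intro mult_left_mono Suc.IH) auto
      then show ?case by (simp add: mult_ac)
    qed
    from contract[OF Suc.prems _ this] show ?case by simp
  qed
  \<comment> \<open>The index used is \<open>Suc n\<close>, which is at least 1 even when
    \<open>n = 0\<close>; its extra factor 1/2 is discarded.\<close>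
  obtain n where n: "(1 / 2 :: real) ^ n < exp (- (l * T))"
    using real_arch_pow_inv[of "exp (- (l * T))" "1 / 2"] by auto
  have "RL_iter \<rho> g (Suc n) t < 1" if "0 \<le> t" "t \<le> T" for t
  proof -
    have "RL_iter \<rho> g (Suc n) t \<le> (1 / 2) ^ Suc n * exp (l * t)"
      using bound[OF that] .
    also have "\<dots> \<le> (1 / 2) ^ n * exp (l * T)"
      using that \<open>0 < l\<close> by (intro mult_mono) auto
    also have "\<dots> < exp (- (l * T)) * exp (l * T)"
      using n by (intro mult_strict_right_mono) auto
    finally show ?thesis by (simp flip: exp_add)
  qed
  then show ?thesis
    by (intro exI[of _ "Suc n"] conjI AE_I2) auto
qed

end
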